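(* Let $M$ be a discretely ordered ring and let $A$ be a commutative ring with identity containing $M$ as a subring. There is a bijective correspondence, given by $\alpha\mapsto(\mathrm{supp}(\alpha),<_\alpha)$, between the set of all $M$-discrete prime cones of $A$ and the set of all pairs $(\mathfrak p,<)$ where $\mathfrak p$ is a real prime ideal of $A$ with $\mathfrak p\cap M=\{0\}$ and $(A/\mathfrak p,<)$ is a discrete extension of $M$. As a special case, there is a bijective correspondence between the set of all $M$-discrete orderings of $A$ and the set of all discrete orderings of $A$ which extend the ordering of $M$.
   Context: An ordered ring is discretely ordered (its ordering is discrete) if it has no element $a$ with $0<a<1$. $M^{\ge0}$ is the set of non-negative elements of $M$. $\mathrm{Spec}_r(A)$ is the real spectrum of $A$, i.e. the set of prime cones $\alpha\subseteq A$; $\mathrm{supp}(\alpha)=\alpha\cap-\alpha$, and $<_\alpha$ is the ordering of $A/\mathrm{supp}(\alpha)$ induced by $\alpha$. $\alpha\in\mathrm{Spec}_r(A)$ is an $M$-discrete prime cone of $A$ if (i) $M^{\ge0}\subseteq\alpha$; (ii) $M^{\ge0}\cap\mathrm{supp}(\alpha)=\{0\}$; (iii) for every $f\in A$, if $f\in\alpha$ and $f\notin\mathrm{supp}(\alpha)$, then $f-1\in\alpha$. It is an $M$-discrete ordering of $A$ if in addition $\mathrm{supp}(\alpha)=\{0\}$. An ordered ring $N$ is a discrete extension of $M$ if $M$ is a subring of $N$, the ordering of $N$ restricts to that of $M$, and $N$ is discretely ordered. When $\mathfrak p\cap M=\{0\}$, $M$ is identified with its image in $A/\mathfrak p$. 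*)

theory Defs
  imports "HOL-Algebra.Algebra"
begin

text \<open>
  An ordering is its strict part, a relation confined to the carrier, so that two relations which
  agree on the carrier are equal and orderings can be counted as relations.
\<close>

locale ordered_cring = cring R for R (structure) +
  fixes lt :: "('a \<times> 'a) set"
  assumes lt_carrier: "lt \<subseteq> carrier R \<times> carrier R"
    and one_neq_zero: "\<one> \<noteq> \<zero>"
    and lt_irrefl: "irrefl lt"
    and lt_trans: "trans lt"
    and lt_total: "total_on (carrier R) lt"
    and lt_add: "\<lbrakk> (a, b) \<in> lt; c \<in> carrier R \<rbrakk> \<Longrightarrow> (a \<oplus> c, b \<oplus> c) \<in> lt"
    and lt_mult: "\<lbrakk> (\<zero>, a) \<in> lt; (\<zero>, b) \<in> lt \<rbrakk> \<Longrightarrow> (\<zero>, a \<otimes> b) \<in> lt"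

locale discretely_ordered_cring = ordered_cring +
  assumes discrete: "\<not> (\<exists>a\<in>carrier R. (\<zero>, a) \<in> lt \<and> (a, \<one>) \<in> lt)"

text \<open>
  The ordered ring being extended is a subset \<open>M\<close> of the carrier of the extension \<open>N\<close>, with the
  operations of \<open>N\<close> and the ordering \<open>ltM\<close>.
\<close>

definition discrete_extension ::
    "('a, 'm) ring_scheme \<Rightarrow> ('a \<times> 'a) set \<Rightarrow> 'a set \<Rightarrow> ('a \<times> 'a) set \<Rightarrow> bool" where
  "discrete_extension N lt M ltM \<longleftrightarrow>
     subring M N \<and> lt \<inter> (M \<times> M) = ltM \<and> discretely_ordered_cring N lt"

locale prime_cone = cring R for R (structure) +
  fixes \<alpha> :: "'a set"
  assumes cone_carrier: "\<alpha> \<subseteq> carrier R"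
    and cone_add: "\<lbrakk> a \<in> \<alpha>; b \<in> \<alpha> \<rbrakk> \<Longrightarrow> a \<oplus> b \<in> \<alpha>"
    and cone_mult: "\<lbrakk> a \<in> \<alpha>; b \<in> \<alpha> \<rbrakk> \<Longrightarrow> a \<otimes> b \<in> \<alpha>"
    and cone_square: "a \<in> carrier R \<Longrightarrow> a \<otimes> a \<in> \<alpha>"
    and cone_proper: "\<ominus> \<one> \<notin> \<alpha>"
    and cone_prime:
      "\<lbrakk> a \<in> carrier R; b \<in> carrier R; a \<otimes> b \<in> \<alpha> \<rbrakk> \<Longrightarrow> a \<in> \<alpha> \<or> \<ominus> b \<in> \<alpha>"

definition real_spectrum :: "('a, 'm) ring_scheme \<Rightarrow> 'a set set" where
  "real_spectrum A = {\<alpha>. prime_cone A \<alpha>}"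

definition supp :: "('a, 'm) ring_scheme \<Rightarrow> 'a set \<Rightarrow> 'a set" where
  "supp A \<alpha> = \<alpha> \<inter> (\<lambda>a. \<ominus>\<^bsub>A\<^esub> a) ` \<alpha>"

text \<open>
  The strict ordering of \<open>A Quot supp A \<alpha>\<close> whose non-negative elements are the classes of the
  elements of \<open>\<alpha>\<close>.
\<close>

definition cone_less :: "('a, 'm) ring_scheme \<Rightarrow> 'a set \<Rightarrow> ('a set \<times> 'a set) set" where
  "cone_less A \<alpha> =
     {(supp A \<alpha> +>\<^bsub>A\<^esub> a, supp A \<alpha> +>\<^bsub>A\<^esub> b) | a b.
        a \<in> carrier A \<and> b \<in> carrier A \<and> b \<ominus>\<^bsub>A\<^esub> a \<in> \<alpha> \<and> b \<ominus>\<^bsub>A\<^esub> a \<notin> supp A \<alpha>}"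

text \<open>
  For \<open>supp A \<alpha> = {\<zero>\<^bsub>A\<^esub>}\<close>, this is \<open>cone_less A \<alpha>\<close> transported to \<open>A\<close> along the canonical
  isomorphism from \<open>A\<close> to \<open>A Quot {\<zero>\<^bsub>A\<^esub>}\<close>.
\<close>

definition cone_less_ring :: "('a, 'm) ring_scheme \<Rightarrow> 'a set \<Rightarrow> ('a \<times> 'a) set" where
  "cone_less_ring A \<alpha> =
     {(a, b). a \<in> carrier A \<and> b \<in> carrier A \<and>
        (supp A \<alpha> +>\<^bsub>A\<^esub> a, supp A \<alpha> +>\<^bsub>A\<^esub> b) \<in> cone_less A \<alpha>}"

definition real_ideal :: "('a, 'm) ring_scheme \<Rightarrow> 'a set \<Rightarrow> bool" where
  "real_ideal A I \<longleftrightarrow> ideal I A \<and>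
     (\<forall>(n::nat) a. a \<in> {..<n} \<rightarrow> carrier A \<longrightarrow>
        (\<Oplus>\<^bsub>A\<^esub>i\<in>{..<n}. a i \<otimes>\<^bsub>A\<^esub> a i) \<in> I \<longrightarrow> (\<forall>i<n. a i \<in> I))"

definition nonneg :: "('a, 'm) ring_scheme \<Rightarrow> 'a set \<Rightarrow> ('a \<times> 'a) set \<Rightarrow> 'a set" where
  "nonneg A M ltM = {m \<in> M. m = \<zero>\<^bsub>A\<^esub> \<or> (\<zero>\<^bsub>A\<^esub>, m) \<in> ltM}"

definition discrete_prime_cone ::
    "('a, 'm) ring_scheme \<Rightarrow> 'a set \<Rightarrow> ('a \<times> 'a) set \<Rightarrow> 'a set \<Rightarrow> bool" where
  "discrete_prime_cone A M ltM \<alpha> \<longleftrightarrow>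
     \<alpha> \<in> real_spectrum A \<and>
     nonneg A M ltM \<subseteq> \<alpha> \<and>
     nonneg A M ltM \<inter> supp A \<alpha> = {\<zero>\<^bsub>A\<^esub>} \<and>
     (\<forall>f\<in>carrier A. f \<in> \<alpha> \<and> f \<notin> supp A \<alpha> \<longrightarrow> f \<ominus>\<^bsub>A\<^esub> \<one>\<^bsub>A\<^esub> \<in> \<alpha>)"

definition discrete_ordering ::
    "('a, 'm) ring_scheme \<Rightarrow> 'a set \<Rightarrow> ('a \<times> 'a) set \<Rightarrow> 'a set \<Rightarrow> bool" where
  "discrete_ordering A M ltM \<alpha> \<longleftrightarrow>
     discrete_prime_cone A M ltM \<alpha> \<and> supp A \<alpha> = {\<zero>\<^bsub>A\<^esub>}"

text \<open>
  Pairs \<open>(\<pp>, <)\<close>: \<open>M\<close> is identified with its image in \<open>A Quot \<pp>\<close>, which carries the image of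
  the ordering of \<open>M\<close>.
\<close>

definition discrete_quotients ::
    "('a, 'm) ring_scheme \<Rightarrow> 'a set \<Rightarrow> ('a \<times> 'a) set \<Rightarrow> ('a set \<times> ('a set \<times> 'a set) set) set" where
  "discrete_quotients A M ltM =
     {(\<pp>, lt). primeideal \<pp> A \<and> real_ideal A \<pp> \<and> \<pp> \<inter> M = {\<zero>\<^bsub>A\<^esub>} \<and>
        discrete_extension (A Quot \<pp>) lt
          ((\<lambda>m. \<pp> +>\<^bsub>A\<^esub> m) ` M)
          ((\<lambda>(x, y). (\<pp> +>\<^bsub>A\<^esub> x, \<pp> +>\<^bsub>A\<^esub> y)) ` ltM)}"

end

theory Submission
  imports Defs
begin

text \<open>
  Both correspondences are instances of one statement about a surjective homomorphism
  \<open>h : A \<rightarrow> B\<close> of commutative rings. A ring ordering of \<open>B\<close> is determined by its non-negative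
  elements, which form a prime cone with support \<open>{0}\<close>, and the preimage of that cone under \<open>h\<close> is
  a prime cone of \<open>A\<close> whose support is the kernel of \<open>h\<close>. Conversely, let \<open>\<alpha>\<close> be a prime cone of
  \<open>A\<close> with support \<open>ker h\<close>. Membership in \<open>\<alpha>\<close> is invariant under adding elements of the support,
  so ``\<open>h a < h b\<close> iff \<open>b - a \<in> \<alpha> - supp \<alpha>\<close>'' is a well-defined relation on \<open>B\<close>, and it is a ring
  ordering. The two constructions are inverse to each other (\<open>push_order_pull_cone\<close> and
  \<open>pull_cone_push_order\<close>).

  Under this dictionary the conditions involving \<open>M\<close> match (\<open>discrete_extension_iff\<close>). An element
  \<open>h f\<close> strictly between \<open>0\<close> and \<open>1\<close> is the same as an \<open>f \<in> \<alpha> - supp \<alpha>\<close> with \<open>f - 1 \<notin> \<alpha>\<close>, so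
  the ordering is discrete iff no such \<open>f\<close> exists. If \<open>ker h\<close> meets \<open>M\<close> only in \<open>0\<close>, then the
  ordering of \<open>B\<close> restricts to that of \<open>M\<close> iff the non-negative elements of \<open>M\<close> lie in \<open>\<alpha>\<close>: since
  the ordering of \<open>M\<close> is total, it suffices that it is preserved.

  Taking for \<open>h\<close> the projection \<open>A \<rightarrow> A/\<pp>\<close> gives the first correspondence restricted to the cones
  with support \<open>\<pp>\<close>; these restrictions fit together because the support of a prime cone is a real
  prime ideal and that of an \<open>M\<close>-discrete one meets \<open>M\<close> only in \<open>0\<close> (\<open>primeideal_supp\<close>,
  \<open>real_ideal_supp\<close>, \<open>supp_inter_M\<close>). Taking the identity of \<open>A\<close> gives the second correspondence.
\<close>

section \<open>The support of a prime cone\<close>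

context prime_cone
begin

lemma supp_iff: "a \<in> supp R \<alpha> \<longleftrightarrow> a \<in> \<alpha> \<and> \<ominus> a \<in> \<alpha>"
  using cone_carrier by (force simp: supp_def image_iff)

lemma cone_closed: "a \<in> \<alpha> \<Longrightarrow> a \<in> carrier R"
  using cone_carrier by blast

lemma supp_closed: "a \<in> supp R \<alpha> \<Longrightarrow> a \<in> carrier R"
  by (simp add: supp_iff cone_closed)

lemma zero_mem: "\<zero> \<in> \<alpha>"
  using cone_square[of \<zero>] by simp

text \<open>Primality of the cone is applied to the square \<open>a\<^sup>2 \<in> \<alpha>\<close>.\<close>

lemma cone_total: "a \<in> carrier R \<Longrightarrow> a \<in> \<alpha> \<or> \<ominus> a \<in> \<alpha>"
  using cone_prime[of a a] cone_square[of a] by blast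

lemma one_notin_supp: "\<one> \<notin> supp R \<alpha>"
  by (simp add: supp_iff cone_proper)

lemma supp_minus: "a \<in> supp R \<alpha> \<Longrightarrow> \<ominus> a \<in> supp R \<alpha>"
  by (simp add: supp_iff cone_closed)

lemma supp_add: "\<lbrakk> a \<in> supp R \<alpha>; b \<in> supp R \<alpha> \<rbrakk> \<Longrightarrow> a \<oplus> b \<in> supp R \<alpha>"
  by (simp add: supp_iff cone_add cone_closed minus_add)

text \<open>
  For a multiplier in \<open>\<alpha>\<close> this is closure of \<open>\<alpha>\<close> under products; any other multiplier is the
  negative of one in \<open>\<alpha>\<close>.
\<close>

lemma supp_mult:
  assumes a: "a \<in> carrier R" and s: "s \<in> supp R \<alpha>"
  shows "a \<otimes> s \<in> supp R \<alpha>"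
proof -
  have *: "c \<otimes> s \<in> supp R \<alpha>" if "c \<in> \<alpha>" for c
    using that s cone_mult[of c s] cone_mult[of c "\<ominus> s"]
    by (simp add: supp_iff cone_closed r_minus)
  show ?thesis
  proof (cases "a \<in> \<alpha>")
    case False
    then have "\<ominus> a \<otimes> s \<in> supp R \<alpha>"
      using cone_total[OF a] * by blast
    then have "\<ominus> (\<ominus> a \<otimes> s) \<in> supp R \<alpha>"
      by (rule supp_minus)
    then show ?thesis
      using a supp_closed[OF s] by (simp add: l_minus)
  qed (rule *)
qed

text \<open>
  As \<open>\<plusminus>ab \<in> \<alpha>\<close>, primality of the cone applies to all four products \<open>(\<plusminus>a)(\<plusminus>b)\<close>. The four
  resulting disjunctions say that each of \<open>a, -a\<close> or each of \<open>b, -b\<close> lies in \<open>\<alpha>\<close>.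
\<close>

lemma supp_prime:
  assumes a: "a \<in> carrier R" and b: "b \<in> carrier R" and ab: "a \<otimes> b \<in> supp R \<alpha>"
  shows "a \<in> supp R \<alpha> \<or> b \<in> supp R \<alpha>"
proof -
  have p: "a \<otimes> b \<in> \<alpha>" and n: "\<ominus> (a \<otimes> b) \<in> \<alpha>"
    using ab by (simp_all add: supp_iff)
  have "a \<in> \<alpha> \<or> \<ominus> b \<in> \<alpha>"
    using cone_prime[of a b] a b p by simp
  moreover have "a \<in> \<alpha> \<or> b \<in> \<alpha>"
    using cone_prime[of a "\<ominus> b"] a b n by (simp add: r_minus)
  moreover have "\<ominus> a \<in> \<alpha> \<or> \<ominus> b \<in> \<alpha>"
    using cone_prime[of "\<ominus> a" b] a b n by (simp add: l_minus)
  moreover have "\<ominus> a \<in> \<alpha> \<or> b \<in> \<alpha>"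
    using cone_prime[of "\<ominus> a" "\<ominus> b"] a b p by (simp add: l_minus r_minus)
  ultimately show ?thesis
    by (auto simp: supp_iff)
qed

lemma primeideal_supp: "primeideal (supp R \<alpha>) R"
proof (rule primeidealI)
  show "ideal (supp R \<alpha>) R"
  proof (rule idealI)
    show "subgroup (supp R \<alpha>) (add_monoid R)"
    proof (rule add.subgroupI)
      show "supp R \<alpha> \<noteq> {}"
        using zero_mem by (force simp: supp_iff)
    qed (auto intro: supp_closed supp_minus supp_add)
    show "a \<otimes> x \<in> supp R \<alpha>" if "a \<in> supp R \<alpha>" "x \<in> carrier R" for a x
      using supp_mult[of x a] that by (simp add: m_comm supp_closed)
  qed (auto intro: ring_axioms supp_mult)
  show "carrier R \<noteq> supp R \<alpha>"
    using one_notin_supp by blast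
qed (use is_cring supp_prime in auto)

text \<open>
  Convexity of the support, as \<open>0 \<le> a \<le> a + b\<close>. It yields transitivity of the induced ordering as
  well as reality of the support.
\<close>

lemma supp_convex:
  assumes "a \<in> \<alpha>" "b \<in> \<alpha>" "a \<oplus> b \<in> supp R \<alpha>"
  shows "a \<in> supp R \<alpha>"
proof -
  have "\<ominus> (a \<oplus> b) \<oplus> b \<in> \<alpha>"
    using assms by (simp add: supp_iff cone_add)
  moreover have "\<ominus> (a \<oplus> b) \<oplus> b = \<ominus> a"
    using assms cone_closed by algebra
  ultimately show ?thesis
    using assms by (simp add: supp_iff)
qed

lemma add_notin_supp:
  assumes "a \<in> \<alpha>" "b \<in> \<alpha>" "a \<notin> supp R \<alpha>"
  shows "a \<oplus> b \<notin> supp R \<alpha>"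
  using supp_convex assms by blast

text \<open>
  All partial sums of squares lie in \<open>\<alpha>\<close>, so by convexity each single square lies in the support
  as soon as the full sum does; the support is prime, hence radical.
\<close>

lemma real_ideal_supp: "real_ideal R (supp R \<alpha>)"
proof -
  have sum_mem: "(\<Oplus>i\<in>{..<n}. a i \<otimes> a i) \<in> \<alpha>"
    if "a \<in> {..<n} \<rightarrow> carrier R" for n :: nat and a
    using that
  proof (induction n)
    case 0
    show ?case by (simp add: zero_mem)
  next
    case (Suc n)
    then have "a \<in> {..<n} \<rightarrow> carrier R" "a n \<in> carrier R" by auto
    then show ?case
      using Suc.IH by (simp add: lessThan_Suc Pi_iff cone_add cone_square)
  qed
  have "\<forall>i<n. a i \<in> supp R \<alpha>"
    if "a \<in> {..<n} \<rightarrow> carrier R" "(\<Oplus>i\<in>{..<n}. a i \<otimes> a i) \<in> supp R \<alpha>" for n :: nat and a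
    using that
  proof (induction n)
    case (Suc n)
    then have a: "a \<in> {..<n} \<rightarrow> carrier R" and an: "a n \<in> carrier R" by auto
    let ?s = "\<Oplus>i\<in>{..<n}. a i \<otimes> a i"
    have s: "?s \<in> \<alpha>" and sq: "a n \<otimes> a n \<in> \<alpha>"
      using sum_mem[OF a] cone_square[OF an] .
    have sum: "a n \<otimes> a n \<oplus> ?s \<in> supp R \<alpha>"
      using Suc.prems(2) a an by (simp add: lessThan_Suc Pi_iff)
    have "a n \<otimes> a n \<in> supp R \<alpha>"
      using supp_convex[OF sq s sum] .
    moreover have "?s \<in> supp R \<alpha>"
      using supp_convex[OF s sq] sum a_comm[OF cone_closed[OF s] cone_closed[OF sq]] by simp
    ultimately show ?case
      using Suc.IH[OF a] supp_prime[OF an an] less_Suc_eq by auto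
  qed simp
  then show ?thesis
    using primeideal_supp by (simp add: real_ideal_def primeideal_def)
qed

end


section \<open>The prime cone of an ordered ring\<close>

context ordered_cring
begin

lemma lt_iff_diff:
  assumes a: "a \<in> carrier R" and b: "b \<in> carrier R"
  shows "(a, b) \<in> lt \<longleftrightarrow> (\<zero>, b \<ominus> a) \<in> lt"
proof
  assume "(a, b) \<in> lt"
  then show "(\<zero>, b \<ominus> a) \<in> lt"
    using lt_add[of a b "\<ominus> a"] a by (simp add: r_neg a_minus_def)
next
  assume "(\<zero>, b \<ominus> a) \<in> lt"
  then have "(\<zero> \<oplus> a, (b \<ominus> a) \<oplus> a) \<in> lt"
    using lt_add a by blast
  moreover have "(b \<ominus> a) \<oplus> a = b"
    using a b by algebra
  ultimately show "(a, b) \<in> lt"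
    using a by simp
qed

lemma lt_asym: "(a, b) \<in> lt \<Longrightarrow> (b, a) \<notin> lt"
  using lt_trans lt_irrefl by (meson irreflD transD)

lemma trichotomy:
  assumes "a \<in> carrier R"
  shows "a = \<zero> \<or> (\<zero>, a) \<in> lt \<or> (\<zero>, \<ominus> a) \<in> lt"
  using assms lt_total lt_iff_diff[of a \<zero>] by (auto simp: total_on_def a_minus_def)

lemma minus_not_pos:
  assumes "(\<zero>, a) \<in> lt"
  shows "(\<zero>, \<ominus> a) \<notin> lt"
proof -
  have a: "a \<in> carrier R" using assms lt_carrier by blast
  show ?thesis
    using lt_asym[OF assms] lt_iff_diff[of a \<zero>] a by (simp add: a_minus_def)
qed

lemma nonneg_iff:
  assumes "a \<in> carrier R"
  shows "a \<in> nonneg R (carrier R) lt \<longleftrightarrow> (\<zero>, \<ominus> a) \<notin> lt"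
  using assms trichotomy[OF assms] minus_not_pos[of a] irreflD[OF lt_irrefl, of \<zero>]
  by (auto simp: nonneg_def)

text \<open>
  Primality of the cone: were \<open>a < 0\<close> and \<open>-b < 0\<close>, then \<open>-ab = (-a)b\<close> would be positive.
\<close>

lemma prime_cone_nonneg: "prime_cone R (nonneg R (carrier R) lt)"
proof -
  let ?P = "nonneg R (carrier R) lt"
  have carrier: "?P \<subseteq> carrier R"
    by (auto simp: nonneg_def)
  have add: "a \<oplus> b \<in> ?P" if ab: "a \<in> ?P" "b \<in> ?P" for a b
  proof (cases "a = \<zero> \<or> b = \<zero>")
    case True
    with ab carrier show ?thesis by auto
  next
    case False
    then have pos: "(\<zero>, a) \<in> lt" "(\<zero>, b) \<in> lt"
      using ab by (auto simp: nonneg_def)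
    have c: "a \<in> carrier R" "b \<in> carrier R"
      using ab carrier by auto
    have "(b, a \<oplus> b) \<in> lt"
      using lt_add[OF pos(1) c(2)] c by simp
    then have "(\<zero>, a \<oplus> b) \<in> lt"
      using pos(2) lt_trans by (meson transD)
    then show ?thesis
      using c by (simp add: nonneg_def)
  qed
  have mult: "a \<otimes> b \<in> ?P" if ab: "a \<in> ?P" "b \<in> ?P" for a b
    using ab lt_mult[of a b] by (auto simp: nonneg_def)
  have square: "a \<otimes> a \<in> ?P" if a: "a \<in> carrier R" for a
  proof -
    have "a \<in> ?P \<or> \<ominus> a \<in> ?P"
      using trichotomy[OF a] a by (auto simp: nonneg_def)
    then show ?thesis
      using mult[of a a] mult[of "\<ominus> a" "\<ominus> a"] a by (auto simp: l_minus r_minus)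
  qed
  have "(\<zero>, \<one>) \<in> lt"
    using square[of \<one>] one_neq_zero by (simp add: nonneg_def)
  then have proper: "\<ominus> \<one> \<notin> ?P"
    by (simp add: nonneg_iff)
  have prime: "a \<in> ?P \<or> \<ominus> b \<in> ?P" if c: "a \<in> carrier R" "b \<in> carrier R" and ab: "a \<otimes> b \<in> ?P" for a b
  proof (rule ccontr)
    assume "\<not> ?thesis"
    then have "(\<zero>, \<ominus> a) \<in> lt" "(\<zero>, b) \<in> lt"
      using c by (simp_all add: nonneg_iff)
    then have "(\<zero>, \<ominus> a \<otimes> b) \<in> lt"
      by (rule lt_mult)
    then show False
      using ab c by (simp add: nonneg_iff l_minus)
  qed
  show ?thesis
    by unfold_locales (use carrier add mult square proper prime in auto)
qed

lemma supp_nonneg: "supp R (nonneg R (carrier R) lt) = {\<zero>}"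
proof -
  interpret P: prime_cone R "nonneg R (carrier R) lt"
    by (rule prime_cone_nonneg)
  have "a = \<zero>" if a: "a \<in> supp R (nonneg R (carrier R) lt)" for a
  proof -
    have c: "a \<in> carrier R"
      using P.supp_closed[OF a] .
    then have "(\<zero>, \<ominus> a) \<notin> lt" "(\<zero>, a) \<notin> lt"
      using a by (simp_all add: P.supp_iff nonneg_iff)
    then show "a = \<zero>"
      using trichotomy[OF c] by blast
  qed
  moreover have "\<zero> \<in> supp R (nonneg R (carrier R) lt)"
    using P.zero_mem by (simp add: P.supp_iff)
  ultimately show ?thesis by blast
qed

lemma lt_iff_nonneg:
  assumes "a \<in> carrier R" "b \<in> carrier R"
  shows "(a, b) \<in> lt \<longleftrightarrow> b \<ominus> a \<in> nonneg R (carrier R) lt \<and> b \<ominus> a \<noteq> \<zero>"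
  unfolding lt_iff_diff[OF assms]
  using assms irreflD[OF lt_irrefl, of \<zero>]
  by (auto simp: nonneg_def simp del: r_right_minus_eq)

end


section \<open>Cones and orderings along a surjective homomorphism\<close>

text \<open>
  The common form of the two orderings attached to a cone: \<open>h\<close> will be the projection modulo the
  support or the identity.
\<close>

definition push_order ::
    "('a, 'm) ring_scheme \<Rightarrow> ('a \<Rightarrow> 'b) \<Rightarrow> 'a set \<Rightarrow> ('b \<times> 'b) set" where
  "push_order A h \<alpha> =
     {(h a, h b) | a b. a \<in> carrier A \<and> b \<in> carrier A \<and>
        b \<ominus>\<^bsub>A\<^esub> a \<in> \<alpha> \<and> b \<ominus>\<^bsub>A\<^esub> a \<notin> supp A \<alpha>}"

definition pull_cone ::
    "('a, 'm) ring_scheme \<Rightarrow> ('b, 'n) ring_scheme \<Rightarrow> ('a \<Rightarrow> 'b) \<Rightarrow> ('b \<times> 'b) set \<Rightarrow> 'a set" where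
  "pull_cone A B h lt = {a \<in> carrier A. h a \<in> nonneg B (carrier B) lt}"

locale surjective_cring_hom = ring_hom_cring +
  assumes surj: "h ` carrier R = carrier S"
begin

lemma mem_kernel: "a \<in> a_kernel R S h \<longleftrightarrow> a \<in> carrier R \<and> h a = \<zero>\<^bsub>S\<^esub>"
  unfolding a_kernel_def' by blast

lemma hom_minus:
  "\<lbrakk> a \<in> carrier R; b \<in> carrier R \<rbrakk> \<Longrightarrow> h (a \<ominus> b) = h a \<ominus>\<^bsub>S\<^esub> h b"
  by (simp add: a_minus_def)

lemma hom_eq_iff:
  "\<lbrakk> a \<in> carrier R; b \<in> carrier R \<rbrakk> \<Longrightarrow> h a = h b \<longleftrightarrow> a \<ominus> b \<in> a_kernel R S h"
  by (simp add: mem_kernel hom_minus)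

text \<open>
  Prime cones pull back along ring homomorphisms, and so do their supports; the cone of
  non-negative elements of \<open>S\<close> has support \<open>{0}\<close>, whose preimage is the kernel.
\<close>

lemma
  assumes "ordered_cring S lt"
  shows prime_cone_pull_cone: "prime_cone R (pull_cone R S h lt)"
    and supp_pull_cone: "supp R (pull_cone R S h lt) = a_kernel R S h"
    and push_order_pull_cone: "push_order R h (pull_cone R S h lt) = lt"
proof -
  interpret O: ordered_cring S lt by fact
  let ?P = "nonneg S (carrier S) lt" and ?\<alpha> = "pull_cone R S h lt"
  interpret P: prime_cone S ?P by (rule O.prime_cone_nonneg)
  show cone: "prime_cone R ?\<alpha>"
  proof (unfold_locales)
    fix a b assume "a \<in> carrier R" "b \<in> carrier R" "a \<otimes> b \<in> ?\<alpha>"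
    then show "a \<in> ?\<alpha> \<or> \<ominus> b \<in> ?\<alpha>"
      using P.cone_prime[of "h a" "h b"] by (auto simp: pull_cone_def)
  qed (auto simp: pull_cone_def P.cone_add P.cone_mult P.cone_square P.cone_proper)
  interpret \<alpha>: prime_cone R ?\<alpha> by fact
  have "a \<in> supp R ?\<alpha> \<longleftrightarrow> a \<in> carrier R \<and> h a \<in> supp S ?P" for a
    unfolding \<alpha>.supp_iff P.supp_iff by (auto simp: pull_cone_def)
  then show supp: "supp R ?\<alpha> = a_kernel R S h"
    unfolding O.supp_nonneg using mem_kernel by blast
  have key: "(h a, h b) \<in> lt \<longleftrightarrow> b \<ominus> a \<in> ?\<alpha> \<and> b \<ominus> a \<notin> supp R ?\<alpha>"
    if "a \<in> carrier R" "b \<in> carrier R" for a b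
  proof -
    have "b \<ominus> a \<in> ?\<alpha> \<longleftrightarrow> h b \<ominus>\<^bsub>S\<^esub> h a \<in> ?P"
      using that by (simp add: pull_cone_def hom_minus)
    moreover have "b \<ominus> a \<in> supp R ?\<alpha> \<longleftrightarrow> h b \<ominus>\<^bsub>S\<^esub> h a = \<zero>\<^bsub>S\<^esub>"
      unfolding supp mem_kernel using that by (simp add: hom_minus)
    ultimately show ?thesis
      using that by (simp add: O.lt_iff_nonneg)
  qed
  show "push_order R h ?\<alpha> = lt"
  proof (rule subset_antisym; rule subrelI)
    fix x y assume "(x, y) \<in> push_order R h ?\<alpha>"
    then show "(x, y) \<in> lt" by (auto simp: push_order_def key)
  next
    fix x y assume xy: "(x, y) \<in> lt"
    then have "x \<in> h ` carrier R" "y \<in> h ` carrier R"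
      using O.lt_carrier surj by auto
    then show "(x, y) \<in> push_order R h ?\<alpha>"
      using xy key by (auto simp: push_order_def)
  qed
qed

end

locale cone_with_kernel_support = surjective_cring_hom + prime_cone R \<alpha> for \<alpha> +
  assumes supp_eq: "supp R \<alpha> = a_kernel R S h"
begin

abbreviation "lt \<equiv> push_order R h \<alpha>"

text \<open>
  The cone is a union of fibres of \<open>h\<close>, which makes the ordering induced on \<open>S\<close> independent of
  representatives.
\<close>

lemma mem_cong_hom:
  assumes c: "a \<in> carrier R" "b \<in> carrier R" and "h a = h b" and "a \<in> \<alpha>"
  shows "b \<in> \<alpha>"
proof -
  have "b \<ominus> a \<in> supp R \<alpha>"
    using assms by (simp add: supp_eq flip: hom_eq_iff)
  then have "a \<oplus> (b \<ominus> a) \<in> \<alpha>"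
    using assms by (simp add: supp_iff cone_add)
  moreover have "a \<oplus> (b \<ominus> a) = b"
    using c by algebra
  ultimately show ?thesis by simp
qed

lemma push_order_iff:
  assumes c: "a \<in> carrier R" "b \<in> carrier R"
  shows "(h a, h b) \<in> lt \<longleftrightarrow> b \<ominus> a \<in> \<alpha> \<and> b \<ominus> a \<notin> supp R \<alpha>"
proof
  assume "(h a, h b) \<in> lt"
  then obtain a' b' where *: "a' \<in> carrier R" "b' \<in> carrier R" "h a = h a'" "h b = h b'"
      "b' \<ominus> a' \<in> \<alpha>" "b' \<ominus> a' \<notin> supp R \<alpha>"
    by (auto simp: push_order_def)
  then have eq: "h (b' \<ominus> a') = h (b \<ominus> a)"
    using c by (simp add: hom_minus)
  then have "b \<ominus> a \<in> \<alpha>"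
    using mem_cong_hom[of "b' \<ominus> a'" "b \<ominus> a"] c * by simp
  moreover have "b \<ominus> a \<notin> supp R \<alpha>"
    using * eq c by (simp add: supp_eq mem_kernel)
  ultimately show "b \<ominus> a \<in> \<alpha> \<and> b \<ominus> a \<notin> supp R \<alpha>" ..
qed (use c in \<open>auto simp: push_order_def\<close>)

lemma pos_iff: "a \<in> carrier R \<Longrightarrow> (\<zero>\<^bsub>S\<^esub>, h a) \<in> lt \<longleftrightarrow> a \<in> \<alpha> \<and> a \<notin> supp R \<alpha>"
  using push_order_iff[of \<zero> a] by (simp add: a_minus_def)

lemma pull_cone_push_order: "pull_cone R S h lt = \<alpha>"
  using cone_closed zero_mem supp_eq
  by (auto simp: pull_cone_def nonneg_def pos_iff mem_kernel supp_iff)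

lemma ordered_cring_push_order: "ordered_cring S lt"
proof
  show "lt \<subseteq> carrier S \<times> carrier S"
    by (auto simp: push_order_def)
  show "\<one>\<^bsub>S\<^esub> \<noteq> \<zero>\<^bsub>S\<^esub>"
    using one_notin_supp by (simp add: supp_eq mem_kernel)
  show "irrefl lt"
  proof (rule irreflI)
    fix x show "(x, x) \<notin> lt"
    proof
      assume "(x, x) \<in> lt"
      then obtain a b where "a \<in> carrier R" "b \<in> carrier R" "h a = h b" "b \<ominus> a \<notin> supp R \<alpha>"
        by (auto simp: push_order_def)
      then show False
        using hom_eq_iff[of b a] by (simp add: supp_eq)
    qed
  qed
  show "trans lt"
  proof (rule transI)
    fix x y z assume xy: "(x, y) \<in> lt" and yz: "(y, z) \<in> lt"
    then obtain a b c where c: "a \<in> carrier R" "b \<in> carrier R" "c \<in> carrier R"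
        and eq: "x = h a" "y = h b" "z = h c"
      by (auto simp: push_order_def)
    have "(b \<ominus> a) \<oplus> (c \<ominus> b) \<in> \<alpha>" "(b \<ominus> a) \<oplus> (c \<ominus> b) \<notin> supp R \<alpha>"
      using xy yz c eq by (simp_all add: push_order_iff cone_add add_notin_supp)
    moreover have "(b \<ominus> a) \<oplus> (c \<ominus> b) = c \<ominus> a"
      using c by algebra
    ultimately show "(x, z) \<in> lt"
      using c eq by (simp add: push_order_iff)
  qed
  show "total_on (carrier S) lt"
  proof (rule total_onI)
    fix x y assume "x \<in> carrier S" "y \<in> carrier S" and ne: "x \<noteq> y"
    then obtain a b where c: "a \<in> carrier R" "b \<in> carrier R" and eq: "x = h a" "y = h b"
      using surj by blast
    have "b \<ominus> a \<notin> supp R \<alpha>" "a \<ominus> b \<notin> supp R \<alpha>"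
      using ne eq c by (simp_all add: supp_eq flip: hom_eq_iff)
    moreover have "\<ominus> (b \<ominus> a) = a \<ominus> b"
      using c by algebra
    ultimately show "(x, y) \<in> lt \<or> (y, x) \<in> lt"
      using c eq cone_total[of "b \<ominus> a"] by (simp add: push_order_iff)
  qed
  show "(x \<oplus>\<^bsub>S\<^esub> z, y \<oplus>\<^bsub>S\<^esub> z) \<in> lt" if xy: "(x, y) \<in> lt" and z: "z \<in> carrier S" for x y z
  proof -
    obtain a b where c: "a \<in> carrier R" "b \<in> carrier R" and eq: "x = h a" "y = h b"
      using xy by (auto simp: push_order_def)
    obtain d where d: "d \<in> carrier R" and eq': "z = h d"
      using z surj by blast
    have "(b \<oplus> d) \<ominus> (a \<oplus> d) = b \<ominus> a"
      using c d by algebra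
    then have "(h (a \<oplus> d), h (b \<oplus> d)) \<in> lt"
      using xy eq c d by (simp add: push_order_iff del: hom_add)
    then show ?thesis
      using c d eq eq' by simp
  qed
  show "(\<zero>\<^bsub>S\<^esub>, x \<otimes>\<^bsub>S\<^esub> y) \<in> lt" if x: "(\<zero>\<^bsub>S\<^esub>, x) \<in> lt" and y: "(\<zero>\<^bsub>S\<^esub>, y) \<in> lt" for x y
  proof -
    obtain a b where c: "a \<in> carrier R" "b \<in> carrier R" and eq: "x = h a" "y = h b"
      using x y by (auto simp: push_order_def)
    then have "a \<otimes> b \<in> \<alpha>" "a \<otimes> b \<notin> supp R \<alpha>"
      using x y supp_prime[of a b] by (auto simp: pos_iff cone_mult)
    then have "(\<zero>\<^bsub>S\<^esub>, h (a \<otimes> b)) \<in> lt"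
      using c by (simp add: pos_iff del: hom_mult)
    then show ?thesis
      using c eq by simp
  qed
qed

text \<open>
  By totality, \<open>h f < 1\<close> fails exactly when \<open>f - 1 \<in> \<alpha>\<close>. This includes the case \<open>h f = 1\<close>, where
  \<open>f - 1\<close> lies in the support and hence in \<open>\<alpha>\<close>.
\<close>

lemma discrete_push_order_iff:
  "discretely_ordered_cring S lt \<longleftrightarrow>
     (\<forall>f\<in>carrier R. f \<in> \<alpha> \<and> f \<notin> supp R \<alpha> \<longrightarrow> f \<ominus> \<one> \<in> \<alpha>)"
proof -
  have upper: "(h f, \<one>\<^bsub>S\<^esub>) \<in> lt \<longleftrightarrow> f \<ominus> \<one> \<notin> \<alpha>" if f: "f \<in> carrier R" for f
  proof -
    have "\<one> \<ominus> f = \<ominus> (f \<ominus> \<one>)"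
      using f by algebra
    then have "(h f, \<one>\<^bsub>S\<^esub>) \<in> lt \<longleftrightarrow> \<ominus> (f \<ominus> \<one>) \<in> \<alpha> \<and> \<ominus> (f \<ominus> \<one>) \<notin> supp R \<alpha>"
      using push_order_iff[of f \<one>] f by simp
    also have "\<dots> \<longleftrightarrow> f \<ominus> \<one> \<notin> \<alpha>"
      using cone_total[of "f \<ominus> \<one>"] f by (auto simp: supp_iff)
    finally show ?thesis .
  qed
  have "discretely_ordered_cring S lt \<longleftrightarrow>
      \<not> (\<exists>x\<in>h ` carrier R. (\<zero>\<^bsub>S\<^esub>, x) \<in> lt \<and> (x, \<one>\<^bsub>S\<^esub>) \<in> lt)"
    using ordered_cring_push_order
    by (simp add: surj discretely_ordered_cring_def discretely_ordered_cring_axioms_def)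
  then show ?thesis
    by (auto simp: pos_iff upper)
qed

end


section \<open>The ordered subring\<close>

locale ordered_subring = cring A for A (structure) +
  fixes M :: "'a set" and ltM :: "('a \<times> 'a) set"
  assumes subring_M: "subring M A"
    and ordered_M: "ordered_cring (A\<lparr>carrier := M\<rparr>) ltM"
begin

sublocale M: ordered_cring "A\<lparr>carrier := M\<rparr>" ltM
  by (rule ordered_M)

lemma M_closed: "m \<in> M \<Longrightarrow> m \<in> carrier A"
  using subringE(1)[OF subring_M] by blast

lemma ltM_closed: "(m, n) \<in> ltM \<Longrightarrow> m \<in> M \<and> n \<in> M"
  using M.lt_carrier by auto

lemma diff_M: "\<lbrakk> m \<in> M; n \<in> M \<rbrakk> \<Longrightarrow> n \<ominus> m \<in> M"
  by (simp add: a_minus_def subringE[OF subring_M])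

lemma nonneg_diff:
  assumes "m \<in> M" "n \<in> M"
  shows "n \<ominus> m \<in> nonneg A M ltM \<longleftrightarrow> m = n \<or> (m, n) \<in> ltM"
proof -
  have [simp]: "m \<in> carrier A" "n \<in> carrier A" "\<ominus> m \<in> M"
    using assms M_closed subringE(5)[OF subring_M] by auto
  have eq: "(n \<ominus> m) \<oplus> m = n"
    by (simp add: a_minus_def a_assoc l_neg)
  have "(m, n) \<in> ltM \<longleftrightarrow> (\<zero>, n \<ominus> m) \<in> ltM"
    using M.lt_add[of m n "\<ominus> m"] M.lt_add[of \<zero> "n \<ominus> m" m] assms eq
    by (auto simp: a_minus_def r_neg)
  moreover have "n \<ominus> m = \<zero> \<longleftrightarrow> m = n"
    by auto
  ultimately show ?thesis
    using diff_M[OF assms] by (simp add: nonneg_def)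
qed

lemma M_total: "\<lbrakk> m \<in> M; n \<in> M \<rbrakk> \<Longrightarrow> m = n \<or> (m, n) \<in> ltM \<or> (n, m) \<in> ltM"
  using M.lt_total by (auto simp: total_on_def)

text \<open>
  Discreteness of the cone speaks of non-negative elements only, but the support is closed under negation
  and every element of \<open>M\<close> is non-negative up to sign.
\<close>

lemma supp_inter_M:
  assumes \<alpha>: "discrete_prime_cone A M ltM \<alpha>"
  shows "supp A \<alpha> \<inter> M = {\<zero>}"
proof -
  interpret prime_cone A \<alpha>
    using \<alpha> by (simp add: discrete_prime_cone_def real_spectrum_def)
  have triv: "nonneg A M ltM \<inter> supp A \<alpha> = {\<zero>}"
    using \<alpha> by (simp add: discrete_prime_cone_def)
  have "m = \<zero>" if m: "m \<in> supp A \<alpha>" "m \<in> M" for m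
  proof -
    have "\<zero> \<in> M"
      using subringE(2)[OF subring_M] .
    then have "m \<ominus> \<zero> \<in> nonneg A M ltM \<or> \<zero> \<ominus> m \<in> nonneg A M ltM"
      using m M_total[of m \<zero>] by (auto simp: nonneg_diff)
    then have "m \<in> nonneg A M ltM \<or> \<ominus> m \<in> nonneg A M ltM"
      using M_closed[OF m(2)] by (simp add: a_minus_def)
    then have "m = \<zero> \<or> \<ominus> m = \<zero>"
      using m(1) supp_minus[OF m(1)] triv by blast
    then show "m = \<zero>"
      using M_closed[OF m(2)] by auto
  qed
  then show ?thesis
    using triv by (auto simp: nonneg_def)
qed

text \<open>
  The embedding of \<open>M\<close> into \<open>B\<close> preserves the ordering iff \<open>\<alpha>\<close> contains the non-negative elements
  of \<open>M\<close>; it then also reflects the ordering, because \<open>n \<le> m\<close> would give \<open>m - n \<in> \<alpha>\<close>,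
  contradicting \<open>h m < h n\<close>.
\<close>

lemma discrete_extension_iff:
  assumes "cone_with_kernel_support A B h \<alpha>" and M: "a_kernel A B h \<inter> M = {\<zero>}"
  shows "discrete_extension B (push_order A h \<alpha>) (h ` M) ((\<lambda>(x, y). (h x, h y)) ` ltM) \<longleftrightarrow>
         discrete_prime_cone A M ltM \<alpha>"
proof -
  interpret C: cone_with_kernel_support A B h \<alpha> by fact
  have sub: "subring (h ` M) B"
    using ring_hom_ring.img_is_subring[OF ring_hom_ringI2 subring_M]
      ring_axioms C.S.ring_axioms C.homh .
  have zero: "nonneg A M ltM \<inter> supp A \<alpha> = {\<zero>}"
    using M C.supp_eq by (auto simp: nonneg_def)
  have restrict: "C.lt \<inter> (h ` M \<times> h ` M) = (\<lambda>(x, y). (h x, h y)) ` ltM \<longleftrightarrow>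
      nonneg A M ltM \<subseteq> \<alpha>" (is "?L \<longleftrightarrow> ?R")
  proof
    assume L: ?L
    have "m \<in> \<alpha>" if "m \<in> M" "(\<zero>, m) \<in> ltM" for m
    proof -
      have "(h \<zero>, h m) \<in> C.lt"
        using L that by force
      then show ?thesis
        using that M_closed by (simp add: C.pos_iff)
    qed
    then show ?R
      using C.zero_mem by (auto simp: nonneg_def)
  next
    assume R: ?R
    have "(h m, h n) \<in> C.lt \<longleftrightarrow> (m, n) \<in> ltM" if mn: "m \<in> M" "n \<in> M" for m n
    proof
      assume lt: "(m, n) \<in> ltM"
      then have "n \<ominus> m \<in> nonneg A M ltM" "m \<noteq> n"
        using mn M.lt_irrefl by (auto simp: nonneg_diff irrefl_def)
      moreover from this have "n \<ominus> m \<notin> supp A \<alpha>"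
        using zero mn M_closed r_right_minus_eq[of n m] by blast
      ultimately show "(h m, h n) \<in> C.lt"
        using R mn M_closed by (auto simp: C.push_order_iff)
    next
      assume lt: "(h m, h n) \<in> C.lt"
      then have *: "n \<ominus> m \<in> \<alpha>" "n \<ominus> m \<notin> supp A \<alpha>"
        using mn M_closed by (auto simp: C.push_order_iff)
      have eq: "m \<ominus> n = \<ominus> (n \<ominus> m)"
        using mn M_closed by algebra
      have "m \<ominus> n \<notin> \<alpha>"
        using * by (simp add: eq C.supp_iff)
      then have "\<not> (m = n \<or> (n, m) \<in> ltM)"
        using R mn nonneg_diff[of n m] by auto
      then show "(m, n) \<in> ltM"
        using M_total[OF mn] by blast
    qed
    then show ?L
      using ltM_closed by fastforce
  qed
  show ?thesis
    using sub zero C.prime_cone_axioms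
    by (simp add: discrete_extension_def discrete_prime_cone_def real_spectrum_def restrict
        C.discrete_push_order_iff)
qed

text \<open>
  The correspondence over a fixed support: the cones whose support is the kernel of \<open>h\<close> against
  the orderings of the image.
\<close>

lemma bij_betw_push_order:
  assumes "surjective_cring_hom A B h" and M: "a_kernel A B h \<inter> M = {\<zero>}"
  shows "bij_betw (push_order A h)
           {\<alpha>. discrete_prime_cone A M ltM \<alpha> \<and> supp A \<alpha> = a_kernel A B h}
           {lt. discrete_extension B lt (h ` M) ((\<lambda>(x, y). (h x, h y)) ` ltM)}"
proof -
  interpret H: surjective_cring_hom A B h by fact
  have cone: "cone_with_kernel_support A B h \<alpha>"
    if "prime_cone A \<alpha>" "supp A \<alpha> = a_kernel A B h" for \<alpha>
    using that H.surjective_cring_hom_axioms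
    by (simp add: cone_with_kernel_support_def cone_with_kernel_support_axioms_def)
  have cone': "cone_with_kernel_support A B h \<alpha>"
    if "discrete_prime_cone A M ltM \<alpha>" "supp A \<alpha> = a_kernel A B h" for \<alpha>
    using that cone by (simp add: discrete_prime_cone_def real_spectrum_def)
  show ?thesis
  proof (rule bij_betw_byWitness[where f' = "pull_cone A B h"])
    show "\<forall>\<alpha>\<in>{\<alpha>. discrete_prime_cone A M ltM \<alpha> \<and> supp A \<alpha> = a_kernel A B h}.
        pull_cone A B h (push_order A h \<alpha>) = \<alpha>"
      using cone' cone_with_kernel_support.pull_cone_push_order by blast
    show "push_order A h ` {\<alpha>. discrete_prime_cone A M ltM \<alpha> \<and> supp A \<alpha> = a_kernel A B h} \<subseteq>
        {lt. discrete_extension B lt (h ` M) ((\<lambda>(x, y). (h x, h y)) ` ltM)}"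
      using discrete_extension_iff[OF cone' M] by blast
    have ord: "ordered_cring B lt"
      if "discrete_extension B lt (h ` M) ((\<lambda>(x, y). (h x, h y)) ` ltM)" for lt
      using that by (simp add: discrete_extension_def discretely_ordered_cring_def)
    show "\<forall>lt\<in>{lt. discrete_extension B lt (h ` M) ((\<lambda>(x, y). (h x, h y)) ` ltM)}.
        push_order A h (pull_cone A B h lt) = lt"
      using ord H.push_order_pull_cone by blast
    show "pull_cone A B h ` {lt. discrete_extension B lt (h ` M) ((\<lambda>(x, y). (h x, h y)) ` ltM)} \<subseteq>
        {\<alpha>. discrete_prime_cone A M ltM \<alpha> \<and> supp A \<alpha> = a_kernel A B h}"
    proof clarify
      fix lt assume ext: "discrete_extension B lt (h ` M) ((\<lambda>(x, y). (h x, h y)) ` ltM)"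
      note o = ord[OF ext]
      have c: "cone_with_kernel_support A B h (pull_cone A B h lt)"
        using cone H.prime_cone_pull_cone[OF o] H.supp_pull_cone[OF o] .
      show "discrete_prime_cone A M ltM (pull_cone A B h lt) \<and>
          supp A (pull_cone A B h lt) = a_kernel A B h"
        using discrete_extension_iff[OF c M] ext
        by (simp add: H.push_order_pull_cone[OF o] H.supp_pull_cone[OF o])
    qed
  qed
qed

end


section \<open>Quotient maps and the identity\<close>

lemma (in ideal) surjective_cring_hom_rcos:
  assumes "cring R"
  shows "surjective_cring_hom R (R Quot I) ((+>) I)"
  using rcos_ring_hom_cring[OF assms]
  by (auto simp: surjective_cring_hom_def surjective_cring_hom_axioms_def FactRing_simps)

lemma (in ideal) a_kernel_rcos: "a_kernel R (R Quot I) ((+>) I) = I"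
  using a_rcos_zero a_rcos_self  by (auto simp: a_kernel_def' FactRing_def a_rcos_const Icarr)

lemma (in cring) surjective_cring_hom_ident: "surjective_cring_hom R R (\<lambda>x. x)"
  by unfold_locales (auto simp: ring_hom_def)

lemma (in cring) a_kernel_ident: "a_kernel R R (\<lambda>x. x) = {\<zero>}"
  by (auto simp: a_kernel_def')

lemma cone_less_eq_push_order: "cone_less A \<alpha> = push_order A ((+>\<^bsub>A\<^esub>) (supp A \<alpha>)) \<alpha>"
  by (simp add: cone_less_def push_order_def)

theorem corollary3p12:
  fixes A :: "('a, 'm) ring_scheme"
    and M :: "'a set"
    and ltM :: "('a \<times> 'a) set"
  assumes "cring A"
    and "subring M A"
    and "discretely_ordered_cring (A\<lparr>carrier := M\<rparr>) ltM"
  shows "bij_betw (\<lambda>\<alpha>. (supp A \<alpha>, cone_less A \<alpha>))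
           {\<alpha>. discrete_prime_cone A M ltM \<alpha>}
           (discrete_quotients A M ltM)
       \<and> bij_betw (cone_less_ring A)
           {\<alpha>. discrete_ordering A M ltM \<alpha>}
           {lt. discrete_extension A lt M ltM}"
proof
  interpret ordered_subring A M ltM
    using assms by (simp add: ordered_subring_def ordered_subring_axioms_def
        discretely_ordered_cring_def)
  let ?dpc = "discrete_prime_cone A M ltM"
  let ?ext = "\<lambda>\<pp> lt. discrete_extension (A Quot \<pp>) lt
          ((\<lambda>m. \<pp> +>\<^bsub>A\<^esub> m) ` M) ((\<lambda>(x, y). (\<pp> +>\<^bsub>A\<^esub> x, \<pp> +>\<^bsub>A\<^esub> y)) ` ltM)"
  have fibre: "bij_betw (push_order A ((+>\<^bsub>A\<^esub>) \<pp>)) {\<alpha>. ?dpc \<alpha> \<and> supp A \<alpha> = \<pp>} {lt. ?ext \<pp> lt}"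
    if "ideal \<pp> A" "\<pp> \<inter> M = {\<zero>\<^bsub>A\<^esub>}" for \<pp>
    using bij_betw_push_order[OF ideal.surjective_cring_hom_rcos[OF that(1) assms(1)]] that
    by (simp add: ideal.a_kernel_rcos)
  have supp_props: "primeideal (supp A \<alpha>) A" "ideal (supp A \<alpha>) A" "real_ideal A (supp A \<alpha>)"
    if "?dpc \<alpha>" for \<alpha>
    using that prime_cone.primeideal_supp[of A \<alpha>] prime_cone.real_ideal_supp[of A \<alpha>]
    by (simp_all add: discrete_prime_cone_def real_spectrum_def real_ideal_def)
  show "bij_betw (\<lambda>\<alpha>. (supp A \<alpha>, cone_less A \<alpha>)) {\<alpha>. ?dpc \<alpha>} (discrete_quotients A M ltM)"
  proof (rule bij_betw_imageI[OF inj_onI subset_antisym[OF subsetI subsetI]])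
    fix \<alpha> \<beta> assume \<alpha>: "\<alpha> \<in> {\<alpha>. ?dpc \<alpha>}" and \<beta>: "\<beta> \<in> {\<alpha>. ?dpc \<alpha>}"
      and eq: "(supp A \<alpha>, cone_less A \<alpha>) = (supp A \<beta>, cone_less A \<beta>)"
    have "inj_on (push_order A ((+>\<^bsub>A\<^esub>) (supp A \<beta>))) {\<alpha>. ?dpc \<alpha> \<and> supp A \<alpha> = supp A \<beta>}"
      using fibre[of "supp A \<beta>"] \<beta> supp_props supp_inter_M by (simp add: bij_betw_def)
    then show "\<alpha> = \<beta>"
      by (rule inj_onD) (use \<alpha> \<beta> eq in \<open>auto simp: cone_less_eq_push_order\<close>)
  next
    fix x assume "x \<in> (\<lambda>\<alpha>. (supp A \<alpha>, cone_less A \<alpha>)) ` {\<alpha>. ?dpc \<alpha>}"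
    then obtain \<alpha> where \<alpha>: "?dpc \<alpha>" and x: "x = (supp A \<alpha>, cone_less A \<alpha>)"
      by blast
    have "?ext (supp A \<alpha>) (cone_less A \<alpha>)"
      using fibre[of "supp A \<alpha>"] \<alpha> supp_props supp_inter_M
      by (auto simp: bij_betw_def cone_less_eq_push_order)
    then show "x \<in> discrete_quotients A M ltM"
      using \<alpha> x supp_props supp_inter_M by (simp add: discrete_quotients_def)
  next
    fix x assume "x \<in> discrete_quotients A M ltM"
    then obtain \<pp> lt where x: "x = (\<pp>, lt)" and \<pp>: "ideal \<pp> A" "\<pp> \<inter> M = {\<zero>\<^bsub>A\<^esub>}"
        and lt: "?ext \<pp> lt"
      by (auto simp: discrete_quotients_def primeideal_def)
    have "lt \<in> push_order A ((+>\<^bsub>A\<^esub>) \<pp>) ` {\<alpha>. ?dpc \<alpha> \<and> supp A \<alpha> = \<pp>}"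
      unfolding bij_betw_imp_surj_on[OF fibre[OF \<pp>]] using lt by simp
    then show "x \<in> (\<lambda>\<alpha>. (supp A \<alpha>, cone_less A \<alpha>)) ` {\<alpha>. ?dpc \<alpha>}"
      using x by (auto simp: cone_less_eq_push_order)
  qed
  have "bij_betw (push_order A (\<lambda>x. x)) {\<alpha>. discrete_ordering A M ltM \<alpha>}
      {lt. discrete_extension A lt M ltM}"
    using bij_betw_push_order[OF surjective_cring_hom_ident] subringE(2)[OF assms(2)]
    by (simp add: a_kernel_ident discrete_ordering_def)
  moreover have "cone_less_ring A \<alpha> = push_order A (\<lambda>x. x) \<alpha>"
    if "discrete_ordering A M ltM \<alpha>" for \<alpha>
  proof -
    have \<alpha>: "?dpc \<alpha>" and supp: "supp A \<alpha> = {\<zero>\<^bsub>A\<^esub>}"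
      using that by (simp_all add: discrete_ordering_def)
    interpret I: ideal "supp A \<alpha>" A
      using supp_props[OF \<alpha>] by simp
    interpret C: cone_with_kernel_support A "A Quot supp A \<alpha>" "(+>\<^bsub>A\<^esub>) (supp A \<alpha>)" \<alpha>
      using \<alpha> I.surjective_cring_hom_rcos[OF assms(1)]
      by (simp add: cone_with_kernel_support_def cone_with_kernel_support_axioms_def
          I.a_kernel_rcos discrete_prime_cone_def real_spectrum_def)
    show ?thesis
      by (auto simp: cone_less_ring_def cone_less_eq_push_order C.push_order_iff)
        (auto simp: push_order_def)
  qed
  ultimately show "bij_betw (cone_less_ring A) {\<alpha>. discrete_ordering A M ltM \<alpha>}
      {lt. discrete_extension A lt M ltM}"
    by (subst bij_betw_cong[of _ _ "push_order A (\<lambda>x. x)"]) auto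
qed

end
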